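(* For bijective structures given by presentations with a single generator $a$ and a single relator (a single identity $t(a)=a$), each elementary first-order sentence $\varphi$ in the language $\{S,S^{-1}\}$ has limiting density equal to $1$ if $\mathbb{Z}\models\varphi$ and equal to $0$ otherwise.
   Context: The language has two unary function symbols $S,S^{-1}$. The variety of bijective structures has axioms $(\forall x)\,SS^{-1}(x)=x$ and $(\forall x)\,S^{-1}S(x)=x$; let $T$ be the theory generated by these. $\mathbb{Z}$ denotes the bijective structure on the integers with $S(x)=x+1$, $S^{-1}(x)=x-1$ (the free structure on one generator). A presentation consists of a generator $a$ and one identity of the form $t(a)=a$, where $t$ is an arbitrary (possibly empty, not necessarily reduced) finite string of the symbols $S,S^{-1}$; the term $t(a)$ is called the relator. The resulting structure is the bijective structure generated by $a$ in which the equations between closed terms in $a$ that hold are exactly those that follow logically from $T$ and the identity. The length of the identity is the number of function symbols in $t$. Let $P_s$ be the number of presentations whose identity has length at most $s$ and $P_s(\varphi)$ the number of these whose resulting structure satisfies $\varphi$. The sentence $\varphi$ has limiting density $d$ if $\lim_{s\to\infty}P_s(\varphi)/P_s=d$. *)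

theory Defs
  imports Complex_Main
begin

section \<open>The language with two unary function symbols\<close>

datatype fsym = S | Sinv

datatype 'v trm = Var 'v | App fsym "'v trm"

text \<open>Equality is the only relation symbol. The remaining connectives and the existential
  quantifier are the usual abbreviations.\<close>

datatype fm = Eq "nat trm" "nat trm" | Neg fm | Conj fm fm | All nat fm

fun fv_fm :: "fm \<Rightarrow> nat set" where
  "fv_fm (Eq u v) = set_trm u \<union> set_trm v"
| "fv_fm (Neg \<phi>) = fv_fm \<phi>"
| "fv_fm (Conj \<phi> \<psi>) = fv_fm \<phi> \<union> fv_fm \<psi>"
| "fv_fm (All x \<phi>) = fv_fm \<phi> - {x}"

definition sentence :: "fm \<Rightarrow> bool" where
  "sentence \<phi> \<longleftrightarrow> fv_fm \<phi> = {}"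

record 'a struct =
  universe :: "'a set"
  interp :: "fsym \<Rightarrow> 'a \<Rightarrow> 'a"

definition is_structure :: "'a struct \<Rightarrow> bool" where
  "is_structure M \<longleftrightarrow> universe M \<noteq> {} \<and> (\<forall>f. \<forall>x\<in>universe M. interp M f x \<in> universe M)"

fun eval_trm :: "'a struct \<Rightarrow> ('v \<Rightarrow> 'a) \<Rightarrow> 'v trm \<Rightarrow> 'a" where
  "eval_trm M e (Var x) = e x"
| "eval_trm M e (App f u) = interp M f (eval_trm M e u)"

fun sat :: "'a struct \<Rightarrow> (nat \<Rightarrow> 'a) \<Rightarrow> fm \<Rightarrow> bool" where
  "sat M e (Eq u v) \<longleftrightarrow> eval_trm M e u = eval_trm M e v"
| "sat M e (Neg \<phi>) \<longleftrightarrow> \<not> sat M e \<phi>"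
| "sat M e (Conj \<phi> \<psi>) \<longleftrightarrow> sat M e \<phi> \<and> sat M e \<psi>"
| "sat M e (All x \<phi>) \<longleftrightarrow> (\<forall>d\<in>universe M. sat M (e(x := d)) \<phi>)"

definition models :: "'a struct \<Rightarrow> fm \<Rightarrow> bool" (infix "\<Turnstile>" 50) where
  "M \<Turnstile> \<phi> \<longleftrightarrow> (\<forall>e. range e \<subseteq> universe M \<longrightarrow> sat M e \<phi>)"

section \<open>Bijective structures\<close>

definition bij_identities :: "(nat trm \<times> nat trm) set" where
  "bij_identities = {(App S (App Sinv (Var 0)), Var 0), (App Sinv (App S (Var 0)), Var 0)}"

definition bij_axioms :: "fm set" where
  "bij_axioms = (\<lambda>(l, r). All 0 (Eq l r)) ` bij_identities"

definition bijective_structure :: "'a struct \<Rightarrow> bool" where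
  "bijective_structure M \<longleftrightarrow> is_structure M \<and> (\<forall>\<phi>\<in>bij_axioms. M \<Turnstile> \<phi>)"

definition int_structure :: "int struct" where
  "int_structure = \<lparr>universe = UNIV, interp = (\<lambda>f x. case f of S \<Rightarrow> x + 1 | Sinv \<Rightarrow> x - 1)\<rparr>"

section \<open>Presentations with one generator and one relator\<close>

text \<open>Closed terms in the generator are terms over a one-element set of generators.\<close>

datatype generator = Gen

type_synonym closed_trm = "generator trm"

text \<open>A presentation is given by its string \<open>t\<close>, with the leftmost symbol outermost:
  the identity is \<open>relator t = Var Gen\<close>, and its length is \<open>length t\<close>.\<close>

type_synonym presentation = "fsym list"

definition relator :: "presentation \<Rightarrow> closed_trm" where
  "relator t = foldr App t (Var Gen)"

fun subst :: "('v \<Rightarrow> 'w trm) \<Rightarrow> 'v trm \<Rightarrow> 'w trm" where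
  "subst \<sigma> (Var x) = \<sigma> x"
| "subst \<sigma> (App f u) = App f (subst \<sigma> u)"

text \<open>Logical consequence of the axioms and the identity of the presentation, for equations
  between closed terms, given by the rules of equational logic. The results \<open>follows_sound\<close>,
  for structures over arbitrary types, and \<open>follows_complete\<close> below show that this is
  semantic consequence.\<close>

inductive follows :: "presentation \<Rightarrow> closed_trm \<Rightarrow> closed_trm \<Rightarrow> bool" for t where
  ax: "(l, r) \<in> bij_identities \<Longrightarrow> follows t (subst \<sigma> l) (subst \<sigma> r)"
| ident: "follows t (relator t) (Var Gen)"
| refl: "follows t u u"
| sym: "follows t u v \<Longrightarrow> follows t v u"
| trans: "follows t u v \<Longrightarrow> follows t v w \<Longrightarrow> follows t u w"
| cong: "follows t u v \<Longrightarrow> follows t (App f u) (App f v)"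

definition follows_rel :: "presentation \<Rightarrow> (closed_trm \<times> closed_trm) set" where
  "follows_rel t = {(u, v). follows t u v}"

definition presented :: "presentation \<Rightarrow> closed_trm set struct" where
  "presented t = \<lparr>universe = UNIV // follows_rel t,
                  interp = (\<lambda>f X. \<Union>u\<in>X. follows_rel t `` {App f u})\<rparr>"

definition gen_class :: "presentation \<Rightarrow> closed_trm set" where
  "gen_class t = follows_rel t `` {Var Gen}"

subsection \<open>The presented structure has the defining properties\<close>

lemma models_All_Eq:
  "(M \<Turnstile> All x (Eq l r)) \<longleftrightarrow> (\<forall>e. range e \<subseteq> universe M \<longrightarrow> eval_trm M e l = eval_trm M e r)"
proof
  assume L: "M \<Turnstile> All x (Eq l r)"
  show "\<forall>e. range e \<subseteq> universe M \<longrightarrow> eval_trm M e l = eval_trm M e r"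
  proof (intro allI impI)
    fix e :: "nat \<Rightarrow> 'a" assume e: "range e \<subseteq> universe M"
    then have "sat M e (All x (Eq l r))" using L by (simp add: models_def)
    moreover have "e x \<in> universe M" using e by (rule subsetD) simp
    ultimately have "sat M (e(x := e x)) (Eq l r)" unfolding sat.simps(4) by (rule bspec)
    then show "eval_trm M e l = eval_trm M e r" by simp
  qed
next
  assume R: "\<forall>e. range e \<subseteq> universe M \<longrightarrow> eval_trm M e l = eval_trm M e r"
  show "M \<Turnstile> All x (Eq l r)"
    unfolding models_def sat.simps
  proof (intro allI impI ballI)
    fix e :: "nat \<Rightarrow> 'a" and d assume "range e \<subseteq> universe M" "d \<in> universe M"
    then have "range (e(x := d)) \<subseteq> universe M" by auto
    then show "eval_trm M (e(x := d)) l = eval_trm M (e(x := d)) r" using R by blast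
  qed
qed

lemma bijective_structure_iff:
  "bijective_structure M \<longleftrightarrow> is_structure M \<and>
     (\<forall>x\<in>universe M. interp M S (interp M Sinv x) = x \<and> interp M Sinv (interp M S x) = x)"
proof -
  have *: "(\<forall>e::nat \<Rightarrow> 'a. range e \<subseteq> universe M \<longrightarrow> P (e 0)) \<longleftrightarrow> (\<forall>x\<in>universe M. P x)" for P
  proof
    assume H: "\<forall>e::nat \<Rightarrow> 'a. range e \<subseteq> universe M \<longrightarrow> P (e 0)"
    show "\<forall>x\<in>universe M. P x"
    proof
      fix x assume "x \<in> universe M"
      then show "P x" using H[rule_format, of "\<lambda>_. x"] by auto
    qed
  next
    assume H: "\<forall>x\<in>universe M. P x"
    show "\<forall>e::nat \<Rightarrow> 'a. range e \<subseteq> universe M \<longrightarrow> P (e 0)"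
    proof (intro allI impI)
      fix e :: "nat \<Rightarrow> 'a" assume "range e \<subseteq> universe M"
      then have "e 0 \<in> universe M" by (rule subsetD) simp
      then show "P (e 0)" using H by simp
    qed
  qed
  show ?thesis
    by (simp add: bijective_structure_def bij_axioms_def bij_identities_def models_All_Eq
        *[of "\<lambda>x. interp M S (interp M Sinv x) = x"]
        *[of "\<lambda>x. interp M Sinv (interp M S x) = x"] ball_conj_distrib)
qed

lemma bijective_int_structure: "bijective_structure int_structure"
  by (auto simp: bijective_structure_iff is_structure_def int_structure_def split: fsym.splits)

lemma eval_trm_in_universe:
  "is_structure M \<Longrightarrow> range e \<subseteq> universe M \<Longrightarrow> eval_trm M e u \<in> universe M"
  by (induction u) (auto simp: is_structure_def)

lemma eval_trm_subst: "eval_trm M e (subst \<sigma> u) = eval_trm M (\<lambda>x. eval_trm M e (\<sigma> x)) u"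
  by (induction u) auto

theorem follows_sound:
  assumes "bijective_structure M" "c \<in> universe M"
    and "eval_trm M (\<lambda>_. c) (relator t) = c"
    and "follows t u v"
  shows "eval_trm M (\<lambda>_. c) u = eval_trm M (\<lambda>_. c) v"
  using assms(4)
proof induction
  case (ax l r \<sigma>)
  have str: "is_structure M" using assms(1) by (simp add: bijective_structure_def)
  have "All 0 (Eq l r) \<in> bij_axioms"
    unfolding bij_axioms_def by (rule image_eqI[OF _ ax]) simp
  then have "M \<Turnstile> All 0 (Eq l r)"
    using assms(1) by (simp add: bijective_structure_def)
  moreover have "range (\<lambda>x. eval_trm M (\<lambda>_. c) (\<sigma> x)) \<subseteq> universe M"
    using eval_trm_in_universe[OF str, of "\<lambda>_ :: generator. c"] assms(2) by blast
  ultimately show ?case by (simp only: models_All_Eq eval_trm_subst)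
qed (use assms in auto)

lemma equiv_follows_rel: "equiv UNIV (follows_rel t)"
proof (rule equivI)
  show "follows_rel t \<subseteq> UNIV \<times> UNIV" by simp
  show "refl_on UNIV (follows_rel t)"
    by (simp add: refl_on_def follows_rel_def follows.refl)
  show "sym (follows_rel t)"
    unfolding sym_def follows_rel_def using follows.sym by blast
  show "trans (follows_rel t)"
    unfolding trans_def follows_rel_def using follows.trans by blast
qed

lemma class_eqI: "follows t u v \<Longrightarrow> follows_rel t `` {u} = follows_rel t `` {v}"
  by (rule equiv_class_eq[OF equiv_follows_rel]) (simp add: follows_rel_def)

lemma interp_presented:
  "interp (presented t) f (follows_rel t `` {u}) = follows_rel t `` {App f u}"
proof -
  have "(\<lambda>u. follows_rel t `` {App f u}) respects follows_rel t"
  proof (rule congruentI)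
    fix u v assume "(u, v) \<in> follows_rel t"
    then have "follows t u v" by (simp add: follows_rel_def)
    then show "follows_rel t `` {App f u} = follows_rel t `` {App f v}"
      by (intro class_eqI follows.cong)
  qed
  from UN_equiv_class[OF equiv_follows_rel this]
  show ?thesis by (simp add: presented_def)
qed

lemma eval_presented:
  "eval_trm (presented t) (\<lambda>_. gen_class t) u = follows_rel t `` {u}"
proof (induction u)
  case (Var x)
  show ?case by (cases x) (simp add: gen_class_def)
qed (simp add: interp_presented)

theorem presented_eq_iff:
  "eval_trm (presented t) (\<lambda>_. gen_class t) u = eval_trm (presented t) (\<lambda>_. gen_class t) v
     \<longleftrightarrow> follows t u v"
  unfolding eval_presented
  using eq_equiv_class_iff[OF equiv_follows_rel] by (simp add: follows_rel_def)

theorem presented_generated: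
  "universe (presented t) = range (eval_trm (presented t) (\<lambda>_ :: generator. gen_class t))"
proof -
  have "universe (presented t) = range (\<lambda>u. follows_rel t `` {u})"
    by (auto simp: presented_def quotient_def)
  then show ?thesis by (simp add: eval_presented)
qed

theorem bijective_presented: "bijective_structure (presented t)"
proof -
  have ax: "follows t (App S (App Sinv u)) u" "follows t (App Sinv (App S u)) u" for u
    using follows.ax[of "App S (App Sinv (Var 0))" "Var 0" t "\<lambda>_. u"]
      follows.ax[of "App Sinv (App S (Var 0))" "Var 0" t "\<lambda>_. u"]
    by (auto simp: bij_identities_def)
  note eqs = ax[THEN class_eqI]
  show ?thesis
    unfolding bijective_structure_iff is_structure_def presented_generated eval_presented
  proof (intro conjI allI ballI)
    show "range (\<lambda>u. follows_rel t `` {u}) \<noteq> {}" by simp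
  next
    fix f X assume "X \<in> range (\<lambda>u. follows_rel t `` {u})"
    then obtain u where "X = follows_rel t `` {u}" by (rule rangeE)
    then have "interp (presented t) f X = follows_rel t `` {App f u}"
      by (simp only: interp_presented)
    then show "interp (presented t) f X \<in> range (\<lambda>u. follows_rel t `` {u})"
      by (rule range_eqI)
  next
    fix X assume "X \<in> range (\<lambda>u. follows_rel t `` {u})"
    then obtain u where X: "X = follows_rel t `` {u}" by (rule rangeE)
    show "interp (presented t) S (interp (presented t) Sinv X) = X"
      "interp (presented t) Sinv (interp (presented t) S X) = X"
      unfolding X interp_presented by (rule eqs)+
  qed
qed

theorem follows_complete:
  assumes "\<And>(M :: closed_trm set struct) c.
      bijective_structure M \<Longrightarrow> c \<in> universe M \<Longrightarrow> eval_trm M (\<lambda>_. c) (relator t) = c \<Longrightarrow>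
      eval_trm M (\<lambda>_. c) u = eval_trm M (\<lambda>_. c) v"
  shows "follows t u v"
proof -
  have "eval_trm (presented t) (\<lambda>_. gen_class t) (relator t) = gen_class t"
    using presented_eq_iff[of t "relator t" "Var Gen"] follows.ident by simp
  moreover have "gen_class t \<in> universe (presented t)"
    by (simp add: gen_class_def presented_def quotientI)
  ultimately have "eval_trm (presented t) (\<lambda>_. gen_class t) u = eval_trm (presented t) (\<lambda>_. gen_class t) v"
    by (intro assms[OF bijective_presented])
  then show ?thesis by (simp only: presented_eq_iff)
qed

section \<open>Limiting density\<close>

definition presentations_upto :: "nat \<Rightarrow> presentation set" where
  "presentations_upto s = {t. length t \<le> s}"

definition limiting_density :: "fm \<Rightarrow> real \<Rightarrow> bool" where
  "limiting_density \<phi> d \<longleftrightarrow>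
     (\<lambda>s. real (card {t \<in> presentations_upto s. presented t \<Turnstile> \<phi>})
           / real (card (presentations_upto s))) \<longlonglongrightarrow> d"

lemma finite_presentations_upto: "finite (presentations_upto s)"
proof -
  have "(UNIV :: fsym set) = {S, Sinv}" using fsym.nchotomy by blast
  then have "finite (UNIV :: fsym set)" by (metis finite.emptyI finite.insertI)
  from finite_lists_length_le[OF this, of s] show ?thesis
    by (simp add: presentations_upto_def)
qed

end

theory Submission
  imports Defs
begin

text \<open>A string \<open>t\<close> with \<open>n\<close> more occurrences of one symbol than of the other presents a structure
  isomorphic to the integers modulo \<open>n\<close>. An Ehrenfeucht--Fraisse argument shows that the integers
  and a sufficiently long cycle satisfy the same sentences up to a given quantifier depth, so every
  sentence has the same truth value as in the integers once \<open>n\<close> is large. The number of strings of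
  length \<open>k\<close> with bounded \<open>n\<close> is at most a constant times the middle binomial coefficient of \<open>k\<close>,
  hence negligible compared with \<open>2 ^ k\<close>.\<close>

section \<open>Shifts\<close>

definition weight :: "fsym \<Rightarrow> int" where
  "weight f = (case f of S \<Rightarrow> 1 | Sinv \<Rightarrow> - 1)"

lemma weight_simps [simp]: "weight S = 1" "weight Sinv = - 1"
  by (simp_all add: weight_def)

definition wt :: "fsym list \<Rightarrow> int" where
  "wt t = sum_list (map weight t)"

text \<open>A term contains exactly one variable occurrence, so in a bijective structure its value
  is determined by that variable and the net translation.\<close>

fun shift :: "'v trm \<Rightarrow> int" where
  "shift (Var x) = 0"
| "shift (App f u) = shift u + weight f"

fun base :: "'v trm \<Rightarrow> 'v" where
  "base (Var x) = x"
| "base (App f u) = base u"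

lemma base_in_set_trm: "base u \<in> set_trm u"
  by (induction u) auto

lemma shift_relator: "shift (relator t) = wt t"
  by (induction t) (auto simp: relator_def wt_def)

text \<open>\<open>M\<close> is isomorphic, through \<open>\<pi>\<close>, to the integers modulo \<open>n\<close>; \<open>n = 0\<close> gives the integers
  themselves, and the sign of \<open>n\<close> is irrelevant.\<close>

definition cyclic :: "'a struct \<Rightarrow> int \<Rightarrow> (int \<Rightarrow> 'a) \<Rightarrow> bool" where
  "cyclic M n \<pi> \<longleftrightarrow> universe M = range \<pi> \<and> (\<forall>f z. interp M f (\<pi> z) = \<pi> (z + weight f)) \<and>
     (\<forall>x y. \<pi> x = \<pi> y \<longleftrightarrow> n dvd x - y)"

lemma cyclic_int_structure: "cyclic int_structure 0 id"
  by (auto simp: cyclic_def int_structure_def weight_def split: fsym.splits)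

lemma eval_trm_cyclic:
  assumes "cyclic M n \<pi>"
  shows "eval_trm M (\<pi> \<circ> a) u = \<pi> (a (base u) + shift u)"
  using assms by (induction u) (simp_all add: cyclic_def add.assoc)

section \<open>The presented structure\<close>

text \<open>The normal form of a closed term: \<open>nat\<close> truncates at 0, so at most one of
  the two blocks is nonempty.\<close>

definition numeral_trm :: "int \<Rightarrow> closed_trm" where
  "numeral_trm z = (App S ^^ nat z) ((App Sinv ^^ nat (- z)) (Var Gen))"

lemma follows_cancel:
  "follows t (App S (App Sinv u)) u" "follows t (App Sinv (App S u)) u"
  using follows.ax[of "App S (App Sinv (Var 0))" "Var 0" t "\<lambda>_. u"]
    follows.ax[of "App Sinv (App S (Var 0))" "Var 0" t "\<lambda>_. u"]
  by (auto simp: bij_identities_def)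

lemma follows_App_numeral: "follows t (App f (numeral_trm z)) (numeral_trm (z + weight f))"
proof (cases f)
  case S
  show ?thesis
  proof (cases "z \<ge> 0")
    case True
    then have "nat (z + 1) = Suc (nat z)" "nat (- z) = 0" "nat (- (z + 1)) = 0" by auto
    then show ?thesis unfolding numeral_trm_def S by (simp add: follows.refl)
  next
    case False
    then have "nat z = 0" "nat (z + 1) = 0" "nat (- z) = Suc (nat (- (z + 1)))" by auto
    then show ?thesis unfolding numeral_trm_def S by (simp add: follows_cancel)
  qed
next
  case Sinv
  show ?thesis
  \<comment> \<open>The threshold is 1: at \<open>z = 0\<close> the symbol \<open>Sinv\<close>
    starts a new block instead of cancelling an \<open>S\<close>.\<close>
  proof (cases "z \<ge> 1")
    case True
    then have "nat z = Suc (nat (z - 1))" "nat (- z) = 0" "nat (- (z - 1)) = 0" by auto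
    then show ?thesis unfolding numeral_trm_def Sinv by (simp add: follows_cancel)
  next
    case False
    then have "nat z = 0" "nat (z - 1) = 0" "nat (- (z - 1)) = Suc (nat (- z))" by auto
    then show ?thesis unfolding numeral_trm_def Sinv by (simp add: follows.refl)
  qed
qed

lemma follows_numeral_shift: "follows t u (numeral_trm (shift u))"
proof (induction u)
  case (Var x)
  then show ?case by (cases x) (simp add: numeral_trm_def follows.refl)
next
  case (App f u)
  show ?case using follows.trans[OF follows.cong[OF App] follows_App_numeral] by simp
qed

lemma follows_numeral_add_weight:
  assumes "follows t (numeral_trm x) (numeral_trm y)"
  shows "follows t (numeral_trm (x + weight f)) (numeral_trm (y + weight f))"
  by (meson assms follows.cong follows.sym follows.trans follows_App_numeral)

lemma follows_numeral_add:
  assumes "follows t (numeral_trm x) (numeral_trm y)"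
  shows "follows t (numeral_trm (x + k)) (numeral_trm (y + k))"
proof (induction k rule: int_induct[of _ 0])
  case base
  show ?case using assms by simp
next
  case (step1 i)
  then show ?case using follows_numeral_add_weight[of t "x + i" "y + i" S] by (simp add: add.assoc)
next
  case (step2 i)
  then show ?case using follows_numeral_add_weight[of t "x + i" "y + i" Sinv] by (simp add: algebra_simps)
qed

text \<open>The identity makes the numeral of \<open>wt t\<close> equal to that of 0. Translating
  this equation gives the period \<open>wt t\<close>, and the induction runs through multiples of
  either sign.\<close>

lemma follows_numeral_mult: "follows t (numeral_trm (x + m * wt t)) (numeral_trm x)"
proof -
  have "follows t (numeral_trm (wt t)) (numeral_trm 0)"
    using follows_numeral_shift[of t "relator t"] follows_numeral_shift[of t "Var Gen"] follows.ident[of t]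
    by (metis follows.sym follows.trans shift_relator shift.simps(1))
  from follows_numeral_add[OF this]
  have *: "follows t (numeral_trm (z + wt t)) (numeral_trm z)" for z
    by (metis add.commute add_0)
  show ?thesis
  proof (induction m rule: int_induct[of _ 0])
    case base
    show ?case by (simp add: follows.refl)
  next
    case (step1 i)
    then show ?case using *[of "x + i * wt t"] by (auto simp: algebra_simps intro: follows.trans)
  next
    case (step2 i)
    then show ?case using *[of "x + (i - 1) * wt t"]
      by (auto simp: algebra_simps intro: follows.trans follows.sym)
  qed
qed

text \<open>The bijection axioms preserve the shift and the identity changes it by
  \<open>wt t\<close>, so divisibility by \<open>wt t\<close> survives every rule. Conversely, both
  terms reduce to numerals, which are periodic.\<close>

lemma follows_iff: "follows t u v \<longleftrightarrow> wt t dvd shift u - shift v"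
proof
  have shift_subst: "shift (subst \<sigma> w) = shift (\<sigma> (base w)) + shift w"
    for \<sigma> :: "nat \<Rightarrow> closed_trm" and w
    by (induction w) auto
  assume "follows t u v"
  then show "wt t dvd shift u - shift v"
  proof induction
    case (trans u v w)
    then show ?case using dvd_add[of "wt t" "shift u - shift v" "shift v - shift w"] by simp
  qed (auto simp: bij_identities_def shift_relator shift_subst dvd_diff_commute)
next
  assume "wt t dvd shift u - shift v"
  then obtain m where "shift u = shift v + m * wt t"
    by (metis dvdE mult.commute add.commute diff_eq_eq)
  then have "follows t (numeral_trm (shift u)) (numeral_trm (shift v))"
    by (simp add: follows_numeral_mult)
  then show "follows t u v"
    by (meson follows_numeral_shift follows.sym follows.trans)
qed

lemma shift_numeral_trm: "shift (numeral_trm z) = z"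
proof -
  have "shift ((App f ^^ k) u) = shift u + int k * weight f" for f k and u :: closed_trm
    by (induction k) (auto simp: algebra_simps)
  then show ?thesis by (simp add: numeral_trm_def)
qed

lemma cyclic_presented: "cyclic (presented t) (wt t) (\<lambda>z. follows_rel t `` {numeral_trm z})"
proof -
  have class_eq: "follows_rel t `` {u} = follows_rel t `` {v} \<longleftrightarrow> follows t u v" for u v
    using eq_equiv_class_iff[OF equiv_follows_rel, of u v t] by (simp add: follows_rel_def)
  have "follows_rel t `` {u} = follows_rel t `` {numeral_trm (shift u)}" for u
    by (rule class_eqI[OF follows_numeral_shift])
  then have "universe (presented t) = range (\<lambda>z. follows_rel t `` {numeral_trm z})"
    by (fastforce simp: presented_generated eval_presented)
  then show ?thesis
    by (simp add: cyclic_def interp_presented class_eq follows_iff shift_numeral_trm)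
qed

section \<open>Back and forth\<close>

text \<open>Modulus 0 stands for the integers, where nothing wraps around, so it counts as
  large.\<close>

definition large :: "nat \<Rightarrow> int \<Rightarrow> bool" where
  "large N n \<longleftrightarrow> n = 0 \<or> int N \<le> \<bar>n\<bar>"

lemma large_mono: "large N n \<Longrightarrow> N' \<le> N \<Longrightarrow> large N' n"
  by (auto simp: large_def)

text \<open>By the pigeonhole principle \<open>F\<close> cannot meet all residue classes. For
  modulus 0 divisibility means equality, and any integer outside \<open>F\<close> serves.\<close>

lemma ex_fresh_residue:
  assumes "finite F" "large N n" "card F < N"
  shows "\<exists>c. \<forall>f\<in>F. \<not> n dvd c - f"
proof (cases "n = 0")
  case True
  then show ?thesis using ex_new_if_finite[OF infinite_UNIV_int assms(1)] by auto
next
  case False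
  have "card ((\<lambda>f. f mod \<bar>n\<bar>) ` F) < card {0..<\<bar>n\<bar>}"
    using card_image_le[OF assms(1), of "\<lambda>f. f mod \<bar>n\<bar>"] assms False by (auto simp: large_def)
  then have "\<not> {0..<\<bar>n\<bar>} \<subseteq> (\<lambda>f. f mod \<bar>n\<bar>) ` F"
    using assms(1) by (meson card_mono finite_imageI not_le)
  then obtain c where c: "0 \<le> c" "c < \<bar>n\<bar>" "c \<notin> (\<lambda>f. f mod \<bar>n\<bar>) ` F"
    by (meson atLeastLessThan_iff subsetI)
  have "\<not> n dvd c - f" if "f \<in> F" for f
  proof
    assume "n dvd c - f"
    then have "c mod \<bar>n\<bar> = f mod \<bar>n\<bar>" by (simp add: mod_eq_dvd_iff)
    then show False using c that by auto
  qed
  then show ?thesis by blast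
qed

text \<open>The game invariant: the tuples \<open>a\<close> and \<open>a'\<close>, read modulo \<open>n\<close> and \<open>n'\<close>, have the same
  differences as far as these are at most \<open>r\<close>.\<close>

definition similar :: "nat \<Rightarrow> nat set \<Rightarrow> int \<Rightarrow> (nat \<Rightarrow> int) \<Rightarrow> int \<Rightarrow> (nat \<Rightarrow> int) \<Rightarrow> bool" where
  "similar r V n a n' a' \<longleftrightarrow>
     (\<forall>x\<in>V. \<forall>y\<in>V. \<forall>k. \<bar>k\<bar> \<le> int r \<longrightarrow> (n dvd a x - a y - k \<longleftrightarrow> n' dvd a' x - a' y - k))"

lemma similar_mono:
  "similar r V n a n' a' \<Longrightarrow> r' \<le> r \<Longrightarrow> V' \<subseteq> V \<Longrightarrow> similar r' V' n a n' a'"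
  unfolding similar_def by (meson order_trans of_nat_mono subsetD)

lemma similar_commute: "similar r V n a n' a' \<longleftrightarrow> similar r V n' a' n a"
  unfolding similar_def by blast

text \<open>Only pairs of \<open>x\<close> with an old entry need the hypothesis on
  \<open>c\<close>: swapping the pair negates \<open>k\<close>, and for \<open>x\<close> paired with
  itself largeness leaves 0 as the only multiple of the modulus in the range of
  \<open>k\<close>.\<close>

lemma similar_insert:
  assumes "similar r V n a n' a'" "x \<notin> V" "large (Suc r) n" "large (Suc r) n'"
    and c: "\<And>y k. y \<in> V \<Longrightarrow> \<bar>k\<bar> \<le> int r \<Longrightarrow> n dvd c - a y - k \<longleftrightarrow> n' dvd c' - a' y - k"
  shows "similar r (insert x V) n (a(x := c)) n' (a'(x := c'))"
proof -
  have self: "m dvd - k \<longleftrightarrow> k = 0" if "large (Suc r) m" "\<bar>k\<bar> \<le> int r" for m k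
    using that dvd_imp_le_int[of k m] by (cases "k = 0") (auto simp: large_def)
  have flip: "n dvd a y - c - k \<longleftrightarrow> n' dvd a' y - c' - k" if "y \<in> V" "\<bar>k\<bar> \<le> int r" for y k
  proof -
    have "m dvd p - q - k \<longleftrightarrow> m dvd q - p - (- k)" for m p q :: int
      using dvd_minus_iff[of m "p - q - k"] by (simp add: algebra_simps)
    then show ?thesis using c[of y "- k"] that by simp
  qed
  have "n dvd (a(x := c)) y - (a(x := c)) z - k \<longleftrightarrow> n' dvd (a'(x := c')) y - (a'(x := c')) z - k"
    if "y \<in> insert x V" "z \<in> insert x V" "\<bar>k\<bar> \<le> int r" for y z k
    using that assms(1,2) c flip self[OF assms(3)] self[OF assms(4)]
    by (cases "y = x"; cases "z = x") (auto simp: similar_def)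
  then show ?thesis unfolding similar_def by blast
qed

text \<open>If \<open>c\<close> is within \<open>r\<close> of some entry of \<open>a\<close>, copy its position relative to the corresponding entry
  of \<open>a'\<close>; otherwise answer with an element far from all entries of \<open>a'\<close>.\<close>

lemma similar_extend:
  assumes "finite V" "x \<notin> V" "similar (2 * r) V n a n' a'"
    and N: "large N n" "large N n'" "N \<ge> Suc (card V) * (2 * r + 1)"
  shows "\<exists>c'. similar r (insert x V) n (a(x := c)) n' (a'(x := c'))"
proof -
  have "similar r V n a n' a'" using assms(3) by (rule similar_mono) auto
  moreover have "Suc r \<le> N" using N(3) by simp
  then have "large (Suc r) n" "large (Suc r) n'" using N large_mono by blast+
  ultimately have *: "\<exists>c'. similar r (insert x V) n (a(x := c)) n' (a'(x := c'))"
    if "\<And>y k. y \<in> V \<Longrightarrow> \<bar>k\<bar> \<le> int r \<Longrightarrow> n dvd c - a y - k \<longleftrightarrow> n' dvd c' - a' y - k" for c'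
    using similar_insert[of r V n a n' a' x c c'] assms(2) that by blast
  show ?thesis
  proof (cases "\<exists>y\<in>V. \<exists>k. \<bar>k\<bar> \<le> int r \<and> n dvd c - a y - k")
    case True
    then obtain y k where y: "y \<in> V" "\<bar>k\<bar> \<le> int r" "n dvd c - a y - k" by blast
    show ?thesis
    proof (rule *[of "a' y + k"])
      fix z l assume z: "z \<in> V" "\<bar>l\<bar> \<le> int r"
      \<comment> \<open>Modulo \<open>n\<close>, \<open>c\<close> is \<open>a y + k\<close>, so an
        offset \<open>l\<close> from \<open>c\<close> becomes \<open>l - k\<close> from
        \<open>a y\<close>. Its absolute value can reach \<open>2 * r\<close>, whence the doubled
        radius in the hypothesis.\<close>
      have "n dvd c - a z - l \<longleftrightarrow> n dvd a y - a z - (l - k)"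
        using dvd_add_right_iff[OF y(3), of "a y - a z - (l - k)"] by (simp add: algebra_simps)
      also have "\<dots> \<longleftrightarrow> n' dvd a' y - a' z - (l - k)"
        using assms(3) y(1,2) z unfolding similar_def by auto
      finally show "n dvd c - a z - l \<longleftrightarrow> n' dvd a' y + k - a' z - l"
        by (simp add: algebra_simps)
    qed
  next
    case False
    \<comment> \<open>The positions within \<open>r\<close> of an entry of \<open>a'\<close>. The
      \<open>Suc\<close> in the bound on \<open>N\<close> makes their number strictly less than
      \<open>N\<close>.\<close>
    let ?F = "(\<lambda>(y, k). a' y + k) ` (V \<times> {- int r..int r})"
    have "card ?F \<le> card V * (2 * r + 1)"
      using card_image_le[of "V \<times> {- int r..int r}" "\<lambda>(y, k). a' y + k"] assms(1)
      by (simp add: card_cartesian_product nat_add_distrib nat_mult_distrib)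
    also have "\<dots> < N" using N(3) by simp
    finally obtain c' where c': "\<forall>f\<in>?F. \<not> n' dvd c' - f"
      using ex_fresh_residue[of ?F N n'] assms(1) N(2) by auto
    have "\<not> n' dvd c' - a' y - k" if "y \<in> V" "\<bar>k\<bar> \<le> int r" for y k
      using c' that by (fastforce simp: algebra_simps)
    then show ?thesis using * False by blast
  qed
qed

text \<open>Induction on the formula, with one \<open>N\<close> serving as lower bound for the
  moduli and as radius of similarity. \<open>V\<close> may exceed the free variables, so that both
  conjuncts can be compared over the same set.\<close>

lemma sat_cyclic_transfer:
  fixes V :: "nat set"
  assumes "finite V" "fv_fm \<phi> \<subseteq> V"
  shows "\<exists>N. \<forall>(M :: 'a struct) n \<pi> a (M' :: 'b struct) n' \<pi>' a'.
    cyclic M n \<pi> \<longrightarrow> cyclic M' n' \<pi>' \<longrightarrow> large N n \<longrightarrow> large N n' \<longrightarrow>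
    similar N V n a n' a' \<longrightarrow> (sat M (\<pi> \<circ> a) \<phi> \<longleftrightarrow> sat M' (\<pi>' \<circ> a') \<phi>)"
  (is "\<exists>N. ?T N V \<phi>")
  using assms
proof (induction \<phi> arbitrary: V)
  case (Eq u v)
  \<comment> \<open>An equation tests a single difference against the fixed offset
    \<open>shift v - shift u\<close>, which the radius must reach.\<close>
  let ?N = "nat \<bar>shift v - shift u\<bar>"
  have vars: "base u \<in> V" "base v \<in> V"
    using Eq base_in_set_trm by fastforce+
  show ?case
  proof (intro exI[of _ ?N] allI impI)
    fix M :: "'a struct" and n \<pi> a and M' :: "'b struct" and n' \<pi>' a'
    assume C: "cyclic M n \<pi>" "cyclic M' n' \<pi>'" and sim: "similar ?N V n a n' a'"
    have "sat M (\<pi> \<circ> a) (Eq u v) \<longleftrightarrow> n dvd a (base u) - a (base v) - (shift v - shift u)"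
      using C(1) by (simp add: eval_trm_cyclic[OF C(1)] cyclic_def algebra_simps)
    also have "\<dots> \<longleftrightarrow> n' dvd a' (base u) - a' (base v) - (shift v - shift u)"
      using sim vars by (simp add: similar_def)
    also have "\<dots> \<longleftrightarrow> sat M' (\<pi>' \<circ> a') (Eq u v)"
      using C(2) by (simp add: eval_trm_cyclic[OF C(2)] cyclic_def algebra_simps)
    finally show "sat M (\<pi> \<circ> a) (Eq u v) \<longleftrightarrow> sat M' (\<pi>' \<circ> a') (Eq u v)" .
  qed
next
  case (Neg \<phi>)
  then show ?case by simp
next
  case (Conj \<phi> \<psi>)
  have "fv_fm \<phi> \<subseteq> V" "fv_fm \<psi> \<subseteq> V" using Conj.prems by auto
  note IH = Conj.IH(1)[OF Conj.prems(1) this(1)] Conj.IH(2)[OF Conj.prems(1) this(2)]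
  from IH(1) obtain N1 where "?T N1 V \<phi>" ..
  note 1 = this[rule_format]
  from IH(2) obtain N2 where "?T N2 V \<psi>" ..
  note 2 = this[rule_format]
  show ?case
  proof (intro exI[of _ "max N1 N2"] allI impI)
    fix M :: "'a struct" and n \<pi> a and M' :: "'b struct" and n' \<pi>' a'
    assume C: "cyclic M n \<pi>" "cyclic M' n' \<pi>'"
      and L: "large (max N1 N2) n" "large (max N1 N2) n'" "similar (max N1 N2) V n a n' a'"
    have 3: "large N' n" "large N' n'" "similar N' V n a n' a'" if "N' \<le> max N1 N2" for N'
      using L(1,2)[THEN large_mono, OF that] similar_mono[OF L(3) that order_refl] by simp_all
    show "sat M (\<pi> \<circ> a) (Conj \<phi> \<psi>) \<longleftrightarrow> sat M' (\<pi>' \<circ> a') (Conj \<phi> \<psi>)"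
      using 1[OF C 3] 2[OF C 3] by simp
  qed
next
  case (All x \<phi>)
  \<comment> \<open>The bound variable loses its old value, and the extension lemma needs a variable
    outside the set.\<close>
  let ?V = "V - {x}"
  have "finite (insert x ?V)" "fv_fm \<phi> \<subseteq> insert x ?V" using All.prems by auto
  from All.IH[OF this] obtain r where "?T r (insert x ?V) \<phi>" ..
  note r = this[rule_format]
  \<comment> \<open>The room required by the extension lemma. It also exceeds \<open>2 * r\<close>,
    the radius from which that lemma descends to \<open>r\<close>.\<close>
  define N where "N = Suc (card ?V) * (2 * r + 1)"
  have N_ge: "2 * r \<le> N" "r \<le> N" by (simp_all add: N_def)
  show ?case
  proof (intro exI[of _ N] allI impI)
    fix M :: "'a struct" and n \<pi> a and M' :: "'b struct" and n' \<pi>' a'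
    assume C: "cyclic M n \<pi>" "cyclic M' n' \<pi>'" and L: "large N n" "large N n'"
      and sim: "similar N V n a n' a'"
    have sim': "similar (2 * r) ?V n a n' a'"
      using sim N_ge by (auto intro: similar_mono)
    note r' = r[OF C L(1)[THEN large_mono, OF N_ge(2)] L(2)[THEN large_mono, OF N_ge(2)]]
    have U: "sat M (\<pi> \<circ> a) (All x \<phi>) \<longleftrightarrow> (\<forall>c. sat M (\<pi> \<circ> a(x := c)) \<phi>)"
      using C(1) by (simp add: cyclic_def fun_upd_comp)
    have U': "sat M' (\<pi>' \<circ> a') (All x \<phi>) \<longleftrightarrow> (\<forall>c. sat M' (\<pi>' \<circ> a'(x := c)) \<phi>)"
      using C(2) by (simp add: cyclic_def fun_upd_comp)
    have V: "finite ?V" "x \<notin> ?V" "Suc (card ?V) * (2 * r + 1) \<le> N"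
      using All.prems(1) by (simp_all add: N_def)
    have forth: "\<exists>c'. sat M (\<pi> \<circ> a(x := c)) \<phi> \<longleftrightarrow> sat M' (\<pi>' \<circ> a'(x := c')) \<phi>" for c
      using similar_extend[OF V(1,2) sim' L V(3), of c] by (elim exE) (rule exI, rule r')
    have conversely: "\<exists>c. sat M (\<pi> \<circ> a(x := c)) \<phi> \<longleftrightarrow> sat M' (\<pi>' \<circ> a'(x := c')) \<phi>" for c'
    proof -
      have "similar (2 * r) ?V n' a' n a" using sim' by (simp only: similar_commute)
      from similar_extend[OF V(1,2) this L(2,1) V(3), of c'] obtain c
        where "similar r (insert x ?V) n (a(x := c)) n' (a'(x := c'))"
        by (auto simp: similar_commute)
      then show ?thesis by (intro exI) (rule r')
    qed
    show "sat M (\<pi> \<circ> a) (All x \<phi>) \<longleftrightarrow> sat M' (\<pi>' \<circ> a') (All x \<phi>)"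
      unfolding U U' using forth conversely by metis
  qed
qed

section \<open>Sentences in presented structures and in the integers\<close>

lemma models_cyclic:
  assumes "cyclic M n \<pi>"
  shows "M \<Turnstile> \<phi> \<longleftrightarrow> (\<forall>a. sat M (\<pi> \<circ> a) \<phi>)"
proof -
  have "range e \<subseteq> universe M \<longleftrightarrow> (\<exists>a. e = \<pi> \<circ> a)" for e :: "nat \<Rightarrow> 'a"
  proof
    assume "range e \<subseteq> universe M"
    then have "\<forall>x. e x \<in> range \<pi>" using assms by (auto simp: cyclic_def)
    then have "e = \<pi> \<circ> (inv \<pi> \<circ> e)" by (simp add: fun_eq_iff f_inv_into_f)
    then show "\<exists>a. e = \<pi> \<circ> a" by (rule exI[of _ "inv \<pi> \<circ> e"])
  next
    assume "\<exists>a. e = \<pi> \<circ> a"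
    then show "range e \<subseteq> universe M" using assms by (auto simp: cyclic_def)
  qed
  then show ?thesis by (auto simp: models_def)
qed

lemma presented_models_iff_int:
  assumes "sentence \<phi>"
  obtains N where "\<And>t. int N \<le> \<bar>wt t\<bar> \<Longrightarrow> presented t \<Turnstile> \<phi> \<longleftrightarrow> int_structure \<Turnstile> \<phi>"
proof -
  have "fv_fm \<phi> \<subseteq> {}" using assms by (simp add: sentence_def)
  from sat_cyclic_transfer[OF finite.emptyI this]
  obtain N where "\<forall>(M :: closed_trm set struct) n \<pi> a (M' :: int struct) n' \<pi>' a'.
    cyclic M n \<pi> \<longrightarrow> cyclic M' n' \<pi>' \<longrightarrow> large N n \<longrightarrow> large N n' \<longrightarrow>
    similar N {} n a n' a' \<longrightarrow> (sat M (\<pi> \<circ> a) \<phi> \<longleftrightarrow> sat M' (\<pi>' \<circ> a') \<phi>)" ..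
  note N = this[rule_format]
  \<comment> \<open>Over the empty set of variables any two assignments are similar, so only the
    size of the modulus matters; modulus 0 of the integers is large.\<close>
  have "presented t \<Turnstile> \<phi> \<longleftrightarrow> int_structure \<Turnstile> \<phi>" if "int N \<le> \<bar>wt t\<bar>" for t
    unfolding models_cyclic[OF cyclic_presented] models_cyclic[OF cyclic_int_structure]
    using N[OF cyclic_presented cyclic_int_structure] that unfolding large_def similar_def by blast
  then show thesis by (rule that)
qed

section \<open>Counting strings of small weight\<close>

lemma UNIV_fsym: "(UNIV :: fsym set) = {S, Sinv}"
  using fsym.nchotomy by blast

lemma finite_UNIV_fsym: "finite (UNIV :: fsym set)" and card_UNIV_fsym: "card (UNIV :: fsym set) = 2"
  by (simp_all add: UNIV_fsym)

lemma card_strings: "card {t :: fsym list. length t = k} = 2 ^ k"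
  using card_lists_length_eq[of "UNIV :: fsym set" k] finite_UNIV_fsym by (simp add: card_UNIV_fsym)

lemma finite_strings: "finite {t :: fsym list. length t = k}"
  using finite_lists_length_eq[of "UNIV :: fsym set" k] finite_UNIV_fsym by simp

text \<open>Splitting on the first symbol reproduces Pascal's recurrence.\<close>

lemma card_strings_count: "card {t :: fsym list. length t = k \<and> count_list t S = j} = k choose j"
proof (induction k arbitrary: j)
  case 0
  have "{t :: fsym list. length t = 0 \<and> count_list t S = j} = (if j = 0 then {[]} else {})" by auto
  then show ?case by (cases j) auto
next
  case (Suc k)
  let ?A = "\<lambda>k j. {t :: fsym list. length t = k \<and> count_list t S = j}"
  have fin: "finite (?A k j)" for j
    by (rule finite_subset[OF _ finite_strings[of k]]) auto
  have dich: "f \<noteq> S \<longleftrightarrow> f = Sinv" for f by (cases f) auto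
  show ?case
  proof (cases j)
    case 0
    have "?A (Suc k) j = (#) Sinv ` ?A k 0"
      by (auto simp: 0 length_Suc_conv dich split: if_splits)
    then show ?thesis using Suc[of 0] by (simp add: card_image 0)
  next
    case (Suc i)
    have "?A (Suc k) j = (#) S ` ?A k i \<union> (#) Sinv ` ?A k j"
      by (auto simp: Suc length_Suc_conv dich split: if_splits)
    moreover have "card \<dots> = (k choose i) + (k choose j)"
      by (subst card_Un_disjoint) (use fin Suc.IH in \<open>auto simp: card_image\<close>)
    ultimately show ?thesis by (simp add: Suc)
  qed
qed

lemma wt_eq_count: "wt t = 2 * int (count_list t S) - int (length t)"
proof (induction t)
  case (Cons f t)
  then show ?case by (cases f) (auto simp: wt_def)
qed (simp add: wt_def)

text \<open>At length \<open>k\<close> the weight is fixed by the number \<open>j\<close> of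
  occurrences of \<open>S\<close>. Distinct \<open>j\<close> have distinct weights in an interval of
  \<open>2 * N\<close> integers, and each \<open>j\<close> accounts for at most the middle binomial
  coefficient.\<close>

lemma card_small_weight_le:
  "card {t. length t = k \<and> \<bar>wt t\<bar> < int N} \<le> 2 * N * (k choose (k div 2))"
proof -
  let ?J = "{j. \<bar>2 * int j - int k\<bar> < int N}"
  have inj: "inj_on (\<lambda>j. 2 * int j - int k) ?J" by (auto simp: inj_on_def)
  have sub: "(\<lambda>j. 2 * int j - int k) ` ?J \<subseteq> {- int N..<int N}" by auto
  have fin: "finite ?J" using finite_imageD[OF finite_subset[OF sub] inj] by simp
  have card: "card ?J \<le> 2 * N"
    using card_inj_on_le[OF inj sub] by simp
  have "card {t. length t = k \<and> \<bar>wt t\<bar> < int N}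
      = card (\<Union>j\<in>?J. {t. length t = k \<and> count_list t S = j})"
    by (rule arg_cong[of _ _ card]) (auto simp: wt_eq_count)
  also have "\<dots> \<le> (\<Sum>j\<in>?J. card {t. length t = k \<and> count_list t S = j})"
    by (rule card_UN_le[OF fin])
  also have "\<dots> \<le> (\<Sum>j\<in>?J. k choose (k div 2))"
    by (rule sum_mono) (simp add: card_strings_count binomial_maximum)
  also have "\<dots> \<le> 2 * N * (k choose (k div 2))"
    using mult_le_mono1[OF card, of "k choose (k div 2)"] by (simp only: sum_constant of_nat_id)
  finally show ?thesis .
qed

section \<open>Growth of the middle binomial coefficient\<close>

text \<open>The bound \<open>4 ^ m / sqrt (2 * m + 1)\<close>, squared to stay in the naturals.
  Successive coefficients have ratio \<open>2 * (2 * m + 1) / (m + 1)\<close>, and the induction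
  closes because \<open>(2 * m + 1) * (2 * m + 3)\<close> is at most
  \<open>4 * (m + 1)^2\<close>.\<close>

lemma central_binomial_sq_le: "((2 * m) choose m)\<^sup>2 * (2 * m + 1) \<le> 16 ^ m"
proof (induction m)
  case (Suc m)
  let ?c = "(2 * m) choose m" and ?d = "(2 * Suc m) choose Suc m"
  have rec: "Suc m * ?d = 2 * (2 * m + 1) * ?c"
  proof -
    have "Suc m * ?d = 2 * Suc m * (Suc (2 * m) choose m)"
      using Suc_times_binomial[of m "Suc (2 * m)"] by (simp add: algebra_simps)
    also have "(Suc (2 * m) choose m) = (Suc (2 * m) choose Suc m)"
      using binomial_symmetric[of m "Suc (2 * m)"] by (simp add: Suc_diff_le)
    also have "2 * Suc m * \<dots> = 2 * (2 * m + 1) * ?c"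
      using Suc_times_binomial[of m "2 * m"] by (simp add: algebra_simps)
    finally show ?thesis .
  qed
  have "(Suc m)\<^sup>2 * (?d\<^sup>2 * (2 * Suc m + 1)) = (Suc m * ?d)\<^sup>2 * (2 * m + 3)"
    by (simp add: power2_eq_square algebra_simps)
  also have "\<dots> = 4 * (2 * m + 1) * (2 * m + 3) * (?c\<^sup>2 * (2 * m + 1))"
    unfolding rec by (simp add: power2_eq_square algebra_simps)
  also have "\<dots> \<le> 4 * (2 * m + 1) * (2 * m + 3) * 16 ^ m"
    using Suc by (rule mult_le_mono2)
  also have "\<dots> \<le> 16 * (Suc m)\<^sup>2 * 16 ^ m"
    by (rule mult_le_mono1) (simp add: power2_eq_square algebra_simps)
  finally have "(Suc m)\<^sup>2 * (?d\<^sup>2 * (2 * Suc m + 1)) \<le> (Suc m)\<^sup>2 * 16 ^ Suc m"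
    by (simp add: algebra_simps)
  then show ?case by (simp only: mult_le_cancel1) simp
qed simp

text \<open>For odd \<open>k\<close> the two middle coefficients are equal and add up to the next
  central one, which reduces the claim to the even bound.\<close>

lemma middle_binomial_sq_le: "(k choose (k div 2))\<^sup>2 * (k + 1) \<le> 4 ^ k"
proof (cases "even k")
  case True
  then obtain m where "k = 2 * m" by (rule evenE)
  then show ?thesis using central_binomial_sq_le[of m] by (simp add: power_mult)
next
  case False
  then obtain m where k: "k = 2 * m + 1" by (rule oddE)
  have "(2 * Suc m) choose Suc m = 2 * (k choose m)"
    using binomial_symmetric[of m k] by (simp add: k Suc_diff_le)
  moreover have "2 * Suc m + 1 = 2 * m + 3" by simp
  ultimately have "(2 * (k choose m))\<^sup>2 * (2 * m + 3) \<le> 16 ^ Suc m"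
    using central_binomial_sq_le[of "Suc m"] by (simp only:)
  moreover have "(16 :: nat) ^ Suc m = 4 * 4 ^ k"
    by (simp add: k power_mult)
  ultimately have "4 * ((k choose m)\<^sup>2 * (2 * m + 3)) \<le> 4 * 4 ^ k"
    by (simp add: power_mult_distrib mult.assoc)
  then have "(k choose m)\<^sup>2 * (2 * m + 3) \<le> 4 ^ k" by simp
  moreover have "(k choose m)\<^sup>2 * (k + 1) \<le> (k choose m)\<^sup>2 * (2 * m + 3)"
    by (rule mult_le_mono2) (simp add: k)
  moreover have "k div 2 = m" by (simp add: k)
  ultimately show ?thesis by (metis order_trans)
qed

text \<open>The squared bound makes the fraction at most the reciprocal of
  \<open>sqrt (k + 1)\<close>.\<close>

lemma middle_binomial_density: "(\<lambda>k. real (k choose (k div 2)) / 2 ^ k) \<longlonglongrightarrow> 0"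
proof (rule tendsto_sandwich[of "\<lambda>_. 0" _ _ "\<lambda>k. 1 / sqrt (real (Suc k))"])
  have "real (k choose (k div 2)) / 2 ^ k \<le> 1 / sqrt (real (Suc k))" for k
  proof -
    have "(real (k choose (k div 2)))\<^sup>2 * real (Suc k) \<le> (2 ^ k)\<^sup>2"
      using of_nat_mono[OF middle_binomial_sq_le[of k], where 'a = real]
      by (simp add: power_mult[symmetric] mult.commute[of k] power_mult distrib_left add.commute)
    then have "real (k choose (k div 2)) * sqrt (real (Suc k)) \<le> 2 ^ k"
      by - (rule power2_le_imp_le, simp_all add: power_mult_distrib)
    then show ?thesis by (simp add: field_simps)
  qed
  then show "\<forall>\<^sub>F k in sequentially. real (k choose (k div 2)) / 2 ^ k \<le> 1 / sqrt (real (Suc k))"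
    by simp
  show "(\<lambda>k. 1 / sqrt (real (Suc k))) \<longlonglongrightarrow> 0"
    using tendsto_real_sqrt[OF LIMSEQ_inverse_real_of_nat]
    by (simp add: real_sqrt_inverse divide_inverse)
qed simp_all

section \<open>Density of the strings of small weight\<close>

lemma card_presentations_upto_ge: "2 ^ s \<le> card (presentations_upto s)"
  unfolding card_strings[symmetric]
  by (rule card_mono[OF finite_presentations_upto]) (auto simp: presentations_upto_def)

text \<open>Vanishing density within each length passes to all lengths up to \<open>s\<close>: from
  some length on, each class contributes at most \<open>e / 2\<close> of its size, while the
  finitely many shorter strings become negligible against the growing total.\<close>

lemma small_weight_density:
  "(\<lambda>s. real (card {t \<in> presentations_upto s. \<bar>wt t\<bar> < int N}) / real (card (presentations_upto s)))
     \<longlonglongrightarrow> 0"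
proof (rule LIMSEQ_I)
  fix e :: real assume "e > 0"
  let ?P = "\<lambda>s. real (card (presentations_upto s))"
  have "(\<lambda>k. 2 * real N * (real (k choose (k div 2)) / 2 ^ k)) \<longlonglongrightarrow> 0"
    using tendsto_mult_right_zero[OF middle_binomial_density] .
  then have "\<forall>\<^sub>F k in sequentially. 2 * real N * (real (k choose (k div 2)) / 2 ^ k) < e / 2"
    using \<open>e > 0\<close> by (intro order_tendstoD) auto
  then obtain k0 where k0: "\<And>k. k \<ge> k0 \<Longrightarrow> 2 * real N * (real (k choose (k div 2)) / 2 ^ k) < e / 2"
    by (auto simp: eventually_sequentially)
  have small: "real (card {t. length t = k \<and> \<bar>wt t\<bar> < int N}) \<le> e / 2 * card {t :: fsym list. length t = k}"
    if "k \<ge> k0" for k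
  proof -
    have "real (card {t. length t = k \<and> \<bar>wt t\<bar> < int N}) \<le> 2 * real N * real (k choose (k div 2))"
      using of_nat_mono[OF card_small_weight_le[of k N], where 'a = real] by simp
    also have "\<dots> \<le> e / 2 * 2 ^ k" using k0[OF that] by (simp add: field_simps)
    finally show ?thesis by (simp add: card_strings)
  qed
  have bound: "real (card {t \<in> presentations_upto s. \<bar>wt t\<bar> < int N}) \<le> ?P k0 + e / 2 * ?P s" for s
  proof -
    \<comment> \<open>Length \<open>k0\<close> is covered twice, harmless for an upper bound. For
      \<open>s < k0\<close> the union over lengths is empty and the first set suffices.\<close>
    have sub: "{t \<in> presentations_upto s. \<bar>wt t\<bar> < int N}
        \<subseteq> presentations_upto k0 \<union> (\<Union>k\<in>{k0..s}. {t. length t = k \<and> \<bar>wt t\<bar> < int N})"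
      by (auto simp: presentations_upto_def)
    have fin: "finite {t. length t = k \<and> \<bar>wt t\<bar> < int N}" for k
      by (rule finite_subset[OF _ finite_strings[of k]]) auto
    have "card {t \<in> presentations_upto s. \<bar>wt t\<bar> < int N}
        \<le> card (presentations_upto k0 \<union> (\<Union>k\<in>{k0..s}. {t. length t = k \<and> \<bar>wt t\<bar> < int N}))"
      by (rule card_mono[OF _ sub]) (simp add: finite_presentations_upto fin)
    also have "\<dots> \<le> card (presentations_upto k0)
        + card (\<Union>k\<in>{k0..s}. {t. length t = k \<and> \<bar>wt t\<bar> < int N})"
      by (rule card_Un_le)
    also have "\<dots> \<le> card (presentations_upto k0)
        + (\<Sum>k\<in>{k0..s}. card {t. length t = k \<and> \<bar>wt t\<bar> < int N})"
      by (intro add_left_mono card_UN_le) simp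
    finally have nat_bound: "card {t \<in> presentations_upto s. \<bar>wt t\<bar> < int N}
        \<le> card (presentations_upto k0)
          + (\<Sum>k\<in>{k0..s}. card {t. length t = k \<and> \<bar>wt t\<bar> < int N})" .
    have "real (card {t \<in> presentations_upto s. \<bar>wt t\<bar> < int N})
        \<le> ?P k0 + (\<Sum>k\<in>{k0..s}. real (card {t. length t = k \<and> \<bar>wt t\<bar> < int N}))"
      using of_nat_mono[OF nat_bound, where 'a = real] by (simp only: of_nat_add of_nat_sum)
    also have "(\<Sum>k\<in>{k0..s}. real (card {t. length t = k \<and> \<bar>wt t\<bar> < int N}))
        \<le> (\<Sum>k\<in>{k0..s}. e / 2 * card {t :: fsym list. length t = k})"
      by (rule sum_mono, rule small) simp
    also have "\<dots> = e / 2 * real (\<Sum>k\<in>{k0..s}. card {t :: fsym list. length t = k})"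
      unfolding of_nat_sum by (rule sum_distrib_left[symmetric])
    also have "(\<Sum>k\<in>{k0..s}. card {t :: fsym list. length t = k})
        = card (\<Union>k\<in>{k0..s}. {t :: fsym list. length t = k})"
      by (rule card_UN_disjoint[symmetric]) (auto simp: finite_strings)
    also have "e / 2 * real \<dots> \<le> e / 2 * ?P s"
      using \<open>e > 0\<close>
      by (intro mult_left_mono of_nat_mono card_mono finite_presentations_upto)
        (auto simp: presentations_upto_def)
    finally show ?thesis by simp
  qed
  \<comment> \<open>For \<open>s \<ge> s0\<close> the total is at least \<open>2 ^ s\<close>, so the
    constant \<open>?P k0\<close> is less than \<open>e / 2\<close> times the total.\<close>
  obtain s0 where s0: "2 * ?P k0 / e < 2 ^ s0"
    using real_arch_pow[of 2 "2 * ?P k0 / e"] by auto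
  show "\<exists>s0. \<forall>s\<ge>s0. norm (real (card {t \<in> presentations_upto s. \<bar>wt t\<bar> < int N}) / ?P s - 0) < e"
  proof (intro exI[of _ s0] allI impI)
    fix s assume "s \<ge> s0"
    then have "(2::real) ^ s0 \<le> 2 ^ s" by simp
    also have "\<dots> \<le> ?P s"
      using of_nat_mono[OF card_presentations_upto_ge[of s], where 'a = real] by simp
    finally have "2 ^ s0 \<le> ?P s" .
    then have "2 * ?P k0 / e < ?P s" and pos: "?P s > 0"
      using s0 zero_less_power[of "2 :: real" s0] by linarith+
    then have "?P k0 < e / 2 * ?P s" using \<open>e > 0\<close> by (simp add: field_simps)
    then show "norm (real (card {t \<in> presentations_upto s. \<bar>wt t\<bar> < int N}) / ?P s - 0) < e"
      using bound[of s] pos by (simp add: field_simps)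
  qed
qed

theorem theorem3p9:
  fixes \<phi> :: fm
  assumes "sentence \<phi>"
  shows "limiting_density \<phi> (if int_structure \<Turnstile> \<phi> then 1 else 0)"
proof -
  obtain N where N: "\<And>t. int N \<le> \<bar>wt t\<bar> \<Longrightarrow> presented t \<Turnstile> \<phi> \<longleftrightarrow> int_structure \<Turnstile> \<phi>"
    using presented_models_iff_int[OF assms] by blast
  let ?P = "\<lambda>s. card (presentations_upto s)"
  let ?small = "\<lambda>s. card {t \<in> presentations_upto s. \<bar>wt t\<bar> < int N}"
  \<comment> \<open>A property confined to small weights has density 0. It is applied to the truth
    of the sentence when the integers refute it, and to its falsity otherwise.\<close>
  have zero: "(\<lambda>s. real (card {t \<in> presentations_upto s. Q t}) / real (?P s)) \<longlonglongrightarrow> 0"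
    if Q: "\<And>t. int N \<le> \<bar>wt t\<bar> \<Longrightarrow> \<not> Q t" for Q
  proof (rule tendsto_sandwich[OF _ _ tendsto_const small_weight_density[of N]])
    have "card {t \<in> presentations_upto s. Q t} \<le> ?small s" for s
      by (rule card_mono) (use Q in \<open>auto simp: finite_presentations_upto not_le[symmetric]\<close>)
    then show "\<forall>\<^sub>F s in sequentially.
        real (card {t \<in> presentations_upto s. Q t}) / real (?P s) \<le> real (?small s) / real (?P s)"
      by (simp add: divide_right_mono)
  qed simp
  show ?thesis
  proof (cases "int_structure \<Turnstile> \<phi>")
    case True
    have "real (card {t \<in> presentations_upto s. presented t \<Turnstile> \<phi>}) / real (?P s)
        = 1 - real (card {t \<in> presentations_upto s. \<not> presented t \<Turnstile> \<phi>}) / real (?P s)" for s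
    proof -
      have "?P s = card {t \<in> presentations_upto s. presented t \<Turnstile> \<phi>}
          + card {t \<in> presentations_upto s. \<not> presented t \<Turnstile> \<phi>}"
        by (subst card_Un_disjoint[symmetric])
          (auto simp: finite_presentations_upto intro: arg_cong[of _ _ card])
      moreover have "?P s > 0"
        by (rule less_le_trans[OF _ card_presentations_upto_ge]) simp
      ultimately have "real (?P s) = real (card {t \<in> presentations_upto s. presented t \<Turnstile> \<phi>})
          + real (card {t \<in> presentations_upto s. \<not> presented t \<Turnstile> \<phi>})" "real (?P s) \<noteq> 0"
        by (simp_all only: of_nat_add of_nat_eq_0_iff)
      then show ?thesis by (simp add: eq_diff_eq add_divide_distrib[symmetric])
    qed
    moreover have "(\<lambda>s. 1 - real (card {t \<in> presentations_upto s. \<not> presented t \<Turnstile> \<phi>}) / real (?P s)) \<longlonglongrightarrow> 1 - 0"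
      by (intro tendsto_diff tendsto_const zero) (simp add: N True)
    ultimately show ?thesis using True by (simp add: limiting_density_def)
  next
    case False
    then show ?thesis using zero[of "\<lambda>t. presented t \<Turnstile> \<phi>"] N by (simp add: limiting_density_def)
  qed
qed

end
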